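(* Let $f$ be such that $f(\mathcal{A})$ and $f(\mathcal{T}_m)$ are well defined. Assume that the matrices $T_1, T_2\in\mathbb{R}^{m\times m}$ are diagonalizable, and let $T_1 = X\Lambda X^{-1}$ and $T_2 = Y\Theta Y^{-1}$ be their eigendecompositions ($\Lambda,\Theta$ diagonal). Let $$g = f(\Theta\otimes I_m + I_m\otimes\Lambda)\,\mathrm{vec}\big(X^{-1}Q_m^T b_1 b_2^T P_m Y^{-T}\big)\in\mathbb{C}^{m^2},$$ and let $G\in\mathbb{C}^{m\times m}$ be such that $g=\mathrm{vec}(G)$. Then $$x_m^{\otimes} = \mathrm{vec}\big(Q_m X G Y^T P_m^T\big).$$
   Context: Here $\otimes$ is the Kronecker product and $\mathrm{vec}$ stacks the columns of a matrix one after the other into a single column vector. Let $M_1\in\mathbb{R}^{n_1\times n_1}$, $M_2\in\mathbb{R}^{n_2\times n_2}$, $\mathcal{A} = M_2\otimes I + I\otimes M_1\in\mathbb{R}^{N\times N}$ with $N=n_1n_2$, and $b=\mathrm{vec}(b_1b_2^T)$ with $b_1\in\mathbb{R}^{n_1}$, $b_2\in\mathbb{R}^{n_2}$. For a matrix $M$ and vector $v$, $K_m(M,v)=\mathrm{span}\{v,Mv,\ldots,M^{m-1}v\}$. The matrices $Q_m\in\mathbb{R}^{n_1\times m}$ and $P_m\in\mathbb{R}^{n_2\times m}$ have orthonormal columns that form bases of $K_m(M_1,b_1)$ and $K_m(M_2,b_2)$, respectively (as generated by the Arnoldi process; both spaces are taken of dimension $m$), and $T_1=Q_m^TM_1Q_m$,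 $T_2=P_m^TM_2P_m$. Set $\mathcal{T}_m = T_2\otimes I_m + I_m\otimes T_1$, where $I_m$ is the $m\times m$ identity. The Kronecker approximation to $f(\mathcal{A})b$ is $$x_m^{\otimes} := (P_m\otimes Q_m)\,f(\mathcal{T}_m)\,(P_m\otimes Q_m)^T b.$$ $Y^{-T}$ denotes the (non-conjugate) transpose of $Y^{-1}$. The function $f$ of a matrix is understood in the usual sense of matrix functions. *)

theory Defs
  imports
    "HOL-Analysis.Analysis"
    "Jordan_Normal_Form.Jordan_Normal_Form"
    "Jordan_Normal_Form.VS_Connect"
begin

no_notation inner (infix "\<bullet>" 70)
no_notation Finite_Cartesian_Product.vec_nth (infixl "$" 90)
hide_const (open) Determinants.det Finite_Cartesian_Product.mat Finite_Cartesian_Product.row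
  Finite_Cartesian_Product.column Finite_Cartesian_Product.vec Finite_Cartesian_Product.transpose

section \<open>Functions of matrices\<close>

text \<open>
  A scalar function is a pair of a domain D and a total function f, of which only the values on D
  matter. Derivatives are taken within D, so that holomorphic functions on an open set and
  differentiable functions on the real line are both covered.
\<close>

definition deriv_within :: "complex set \<Rightarrow> (complex \<Rightarrow> complex) \<Rightarrow> complex \<Rightarrow> complex" where
  "deriv_within D f z = (THE d. (f has_field_derivative d) (at z within D))"

definition nth_deriv_within ::
    "nat \<Rightarrow> complex set \<Rightarrow> (complex \<Rightarrow> complex) \<Rightarrow> complex \<Rightarrow> complex" where
  "nth_deriv_within j D f = (deriv_within D ^^ j) f"

text \<open>
  The \<open>j\<close>-th derivative of f exists at z. The condition \<open>at z within D \<noteq> bot\<close> (z is a limit point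
  of D) makes derivatives within D unique.
\<close>

primrec has_nth_deriv_within ::
    "nat \<Rightarrow> complex set \<Rightarrow> (complex \<Rightarrow> complex) \<Rightarrow> complex \<Rightarrow> bool" where
  "has_nth_deriv_within 0 D f z \<longleftrightarrow> z \<in> D"
| "has_nth_deriv_within (Suc j) D f z \<longleftrightarrow>
     at z within D \<noteq> bot \<and>
     has_nth_deriv_within j D f z \<and>
     (\<forall>\<^sub>F w in at z within D. has_nth_deriv_within j D f w) \<and>
     nth_deriv_within j D f field_differentiable (at z within D)"

text \<open>
  f is defined on the spectrum of A: at an eigenvalue whose largest Jordan block has size k, the
  derivatives of order \<open>0, \<dots>, k - 1\<close> exist.
\<close>

definition mat_fun_defined :: "complex set \<Rightarrow> (complex \<Rightarrow> complex) \<Rightarrow> complex mat \<Rightarrow> bool" where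
  "mat_fun_defined D f A \<longleftrightarrow>
     (\<exists>n_as. jordan_nf A n_as \<and> (\<forall>(k, a) \<in> set n_as. has_nth_deriv_within (k - 1) D f a))"

definition jordan_block_fun ::
    "complex set \<Rightarrow> (complex \<Rightarrow> complex) \<Rightarrow> nat \<Rightarrow> complex \<Rightarrow> complex mat" where
  "jordan_block_fun D f k a =
     mat k k (\<lambda>(i, j). if i \<le> j then nth_deriv_within (j - i) D f a / fact (j - i) else 0)"

definition jordan_matrix_fun ::
    "complex set \<Rightarrow> (complex \<Rightarrow> complex) \<Rightarrow> (nat \<times> complex) list \<Rightarrow> complex mat" where
  "jordan_matrix_fun D f n_as = diag_block_mat (map (\<lambda>(k, a). jordan_block_fun D f k a) n_as)"

text \<open>
  The primary matrix function via the Jordan canonical form; the value does not depend on the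
  choice of the Jordan decomposition.
\<close>

definition mat_fun :: "complex set \<Rightarrow> (complex \<Rightarrow> complex) \<Rightarrow> complex mat \<Rightarrow> complex mat" where
  "mat_fun D f A =
     (THE F. \<exists>n_as S S'. 0 \<notin> fst ` set n_as \<and> similar_mat_wit A (jordan_matrix n_as) S S' \<and>
        F = S * jordan_matrix_fun D f n_as * S')"


section \<open>Kronecker products and vectorization\<close>

definition kron :: "'a::semiring_1 mat \<Rightarrow> 'a mat \<Rightarrow> 'a mat" (infixl "\<otimes>\<^sub>K" 70) where
  "A \<otimes>\<^sub>K B = mat (dim_row A * dim_row B) (dim_col A * dim_col B)
     (\<lambda>(i, j). A $$ (i div dim_row B, j div dim_col B) * B $$ (i mod dim_row B, j mod dim_col B))"

definition stack_cols :: "'a mat \<Rightarrow> 'a vec" where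
  "stack_cols A = vec (dim_row A * dim_col A) (\<lambda>k. A $$ (k mod dim_row A, k div dim_row A))"

text \<open>\<open>outer_prod u v\<close> is the product of the column \<open>u\<close> with the row \<open>v\<^sup>T\<close>.\<close>

definition outer_prod :: "'a::semiring_1 vec \<Rightarrow> 'a vec \<Rightarrow> 'a mat" where
  "outer_prod u v = mat_of_cols (dim_vec u) [u] * mat_of_rows (dim_vec v) [v]"


section \<open>Krylov spaces and the Kronecker approximation\<close>

definition krylov :: "nat \<Rightarrow> real mat \<Rightarrow> real vec \<Rightarrow> real vec set" where
  "krylov m M v = LinearCombinations.module.span class_ring (module_vec TYPE(real) (dim_vec v))
     {(M ^\<^sub>m i) *\<^sub>v v | i. i < m}"

text \<open>
  Orthonormal columns are linearly independent, so that a matrix with \<open>m\<close> columns satisfying this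
  can only exist if W has dimension \<open>m\<close>.
\<close>

definition orthonormal_basis_cols :: "real mat \<Rightarrow> real vec set \<Rightarrow> bool" where
  "orthonormal_basis_cols Q W \<longleftrightarrow>
     (\<forall>i < dim_col Q. \<forall>j < dim_col Q. col Q i \<bullet> col Q j = (if i = j then 1 else 0)) \<and>
     LinearCombinations.module.span class_ring (module_vec TYPE(real) (dim_row Q)) (set (cols Q)) = W"

abbreviation cmat :: "real mat \<Rightarrow> complex mat" where
  "cmat \<equiv> map_mat complex_of_real"

abbreviation cvec :: "real vec \<Rightarrow> complex vec" where
  "cvec \<equiv> map_vec complex_of_real"

text \<open>The Kronecker sum, in which the second summand varies fastest.\<close>

definition kron_sum :: "'a::semiring_1 mat \<Rightarrow> 'a mat \<Rightarrow> 'a mat" where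
  "kron_sum A B = A \<otimes>\<^sub>K 1\<^sub>m (dim_row B) + 1\<^sub>m (dim_row A) \<otimes>\<^sub>K B"

definition kron_approx ::
    "complex set \<Rightarrow> (complex \<Rightarrow> complex) \<Rightarrow> real mat \<Rightarrow> real mat \<Rightarrow> real mat \<Rightarrow> real mat \<Rightarrow>
     real vec \<Rightarrow> complex vec" where
  "kron_approx D f M1 M2 Q P b =
     (cmat (P \<otimes>\<^sub>K Q) * mat_fun D f (cmat (kron_sum (P\<^sup>T * M2 * P) (Q\<^sup>T * M1 * Q))) *
      cmat ((P \<otimes>\<^sub>K Q)\<^sup>T)) *\<^sub>v cvec b"

end

theory Submission
  imports Defs "Jordan_Normal_Form.Jordan_Normal_Form_Uniqueness"
begin

text \<open>
  Three facts combine. A primary matrix function commutes with similarity,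
  \<open>f(S Z S\<^sup>-\<^sup>1) = S f(Z) S\<^sup>-\<^sup>1\<close> (\<open>mat_fun_similar_diagonal\<close>, for diagonal \<open>Z\<close>). If
  \<open>T\<^sub>1 = X \<Lambda> X\<^sup>-\<^sup>1\<close> and \<open>T\<^sub>2 = Y \<Theta> Y\<^sup>-\<^sup>1\<close>, then the Kronecker sum of \<open>T\<^sub>2\<close> and \<open>T\<^sub>1\<close> is
  diagonalized by \<open>Y \<otimes> X\<close>, and its diagonal form is the Kronecker sum of \<open>\<Theta>\<close> and \<open>\<Lambda>\<close>
  (\<open>kron_sum_similar\<close>, from the mixed-product rule). Finally,
  \<open>(A \<otimes> B) vec(W) = vec(B W A\<^sup>T)\<close> (\<open>kron_mult_stack_cols\<close>).
  Hence, reading the definition of the approximation from right to left, the factors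
  \<open>Y\<^sup>-\<^sup>1 \<otimes> X\<^sup>-\<^sup>1\<close> and \<open>P\<^sup>T \<otimes> Q\<^sup>T\<close> turn \<open>vec(b\<^sub>1 b\<^sub>2\<^sup>T)\<close> into the vector to which the
  diagonal matrix \<open>f(\<Theta> \<otimes> I + I \<otimes> \<Lambda>)\<close> is applied in the definition of \<open>g = vec(G)\<close>, and
  the factors \<open>P \<otimes> Q\<close> and \<open>Y \<otimes> X\<close> turn \<open>vec(G)\<close> into \<open>vec(Q X G Y\<^sup>T P\<^sup>T)\<close>.

  The first fact needs care because the value of the matrix function is the unique matrix that
  some Jordan decomposition yields. For a diagonalizable matrix every Jordan block has
  size one, by uniqueness of the Jordan normal form, so only the values of \<open>f\<close> at the eigenvalues enter; and two
  diagonalizations give the same value because \<open>Z W = W J\<close> with \<open>Z\<close>, \<open>J\<close> diagonal says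
  \<open>z\<^sub>i w\<^sub>i\<^sub>j = w\<^sub>i\<^sub>j d\<^sub>j\<close> for their diagonal entries, which implies
  \<open>f(z\<^sub>i) w\<^sub>i\<^sub>j = w\<^sub>i\<^sub>j f(d\<^sub>j)\<close> (\<open>diag_fun_intertwines\<close>).
\<close>

section \<open>Functions of diagonalizable matrices\<close>

lemma diagonal_mult_index:
  assumes Z: "Z \<in> carrier_mat n n" "diagonal_mat Z" and W: "W \<in> carrier_mat n k"
    and ij: "i < n" "j < k"
  shows "(Z * W) $$ (i, j) = Z $$ (i, i) * (W $$ (i, j) :: 'a :: comm_semiring_1)"
proof -
  have "(Z * W) $$ (i, j) = (\<Sum>l<n. Z $$ (i, l) * W $$ (l, j))"
    using Z W ij by (simp add: scalar_prod_def lessThan_atLeast0)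
  also have "\<dots> = (\<Sum>l<n. if l = i then Z $$ (i, i) * W $$ (i, j) else 0)"
    using Z ij by (intro sum.cong) (auto simp: diagonal_mat_def)
  finally show ?thesis using ij by simp
qed

lemma mult_diagonal_index:
  assumes W: "W \<in> carrier_mat k n" and Z: "Z \<in> carrier_mat n n" "diagonal_mat Z"
    and ij: "i < k" "j < n"
  shows "(W * Z) $$ (i, j) = W $$ (i, j) * (Z $$ (j, j) :: 'a :: comm_semiring_1)"
proof -
  have "(W * Z) $$ (i, j) = (\<Sum>l<n. W $$ (i, l) * Z $$ (l, j))"
    using Z W ij by (simp add: scalar_prod_def lessThan_atLeast0)
  also have "\<dots> = (\<Sum>l<n. if l = j then W $$ (i, j) * Z $$ (j, j) else 0)"
    using Z ij by (intro sum.cong) (auto simp: diagonal_mat_def)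
  finally show ?thesis using ij by simp
qed

lemma similar_mat_wit_intertwines:
  assumes "similar_mat_wit A B P Q"
  shows "A * P = P * B"
proof -
  define n where "n = dim_row A"
  note w = similar_mat_witD[OF n_def assms]
  have "A * P = P * B * (Q * P)"
    unfolding w(3) by (rule assoc_mult_mat[OF mult_carrier_mat[OF w(6,5)] w(7,6)])
  also have "\<dots> = P * B" unfolding w(2) using w(5,6) by simp
  finally show ?thesis .
qed

definition diag_fun :: "('a \<Rightarrow> 'b::zero) \<Rightarrow> 'a mat \<Rightarrow> 'b mat" where
  "diag_fun f Z = mat (dim_row Z) (dim_row Z) (\<lambda>(i, j). if i = j then f (Z $$ (i, i)) else 0)"

lemma diag_fun_carrier [simp]: "Z \<in> carrier_mat n n \<Longrightarrow> diag_fun f Z \<in> carrier_mat n n"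
  by (auto simp: diag_fun_def)

lemma diag_fun_diagonal [simp]: "diagonal_mat (diag_fun f Z)"
  by (auto simp: diag_fun_def diagonal_mat_def)

text \<open>
  Entry \<open>(i, j)\<close> of the hypothesis reads \<open>(z\<^sub>i - d\<^sub>j) w\<^sub>i\<^sub>j = 0\<close>, where \<open>z\<^sub>i\<close> and \<open>d\<^sub>j\<close> are the
  diagonal entries of \<open>Z\<close> and \<open>J\<close>: wherever \<open>W\<close> does not vanish, they agree, and so do the
  values of \<open>f\<close> at them.
\<close>

lemma diag_fun_intertwines:
  fixes Z J W :: "'a :: idom mat"
  assumes Z: "Z \<in> carrier_mat n n" "diagonal_mat Z" and J: "J \<in> carrier_mat n n" "diagonal_mat J"
    and W: "W \<in> carrier_mat n n" and eq: "Z * W = W * J"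
  shows "diag_fun f Z * W = W * diag_fun f J"
proof (rule eq_matI)
  fix i j assume "i < dim_row (W * diag_fun f J)" "j < dim_col (W * diag_fun f J)"
  then have ij: "i < n" "j < n" using W J by (auto simp: diag_fun_def)
  have "Z $$ (i, i) * W $$ (i, j) = W $$ (i, j) * J $$ (j, j)"
    using arg_cong[OF eq, of "\<lambda>M. M $$ (i, j)"]
    by (simp add: diagonal_mult_index[OF Z W ij] mult_diagonal_index[OF W J ij])
  then have "W $$ (i, j) = 0 \<or> Z $$ (i, i) = J $$ (j, j)" by (simp add: mult.commute)
  then show "(diag_fun f Z * W) $$ (i, j) = (W * diag_fun f J) $$ (i, j)"
    using Z J ij
    by (auto simp: diagonal_mult_index[OF _ _ W ij] mult_diagonal_index[OF W _ _ ij])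
      (auto simp: diag_fun_def mult.commute)
qed (use Z J W in \<open>auto simp: diag_fun_def\<close>)

lemma diag_block_mat_singletons:
  "diag_block_mat (map (\<lambda>a. mat 1 1 (\<lambda>_. h a)) as) =
     mat (length as) (length as) (\<lambda>(i, j). if i = j then h (as ! i) else 0)"
proof (induction as)
  case Nil
  show ?case by (rule eq_matI) auto
next
  case (Cons a as)
  show ?case
    by (rule eq_matI) (auto simp: Let_def Cons.IH[simplified] nth_Cons split: nat.splits)
qed

lemma jordan_matrix_singletons:
  "jordan_matrix (map (Pair 1) as) =
     mat (length as) (length as) (\<lambda>(i, j). if i = j then as ! i else 0)"
proof -
  have "(case Pair (Suc 0) a of (n, a) \<Rightarrow> jordan_block n a) = mat 1 1 (\<lambda>_. a)" for a :: 'a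
    by (rule eq_matI) (auto simp: jordan_block_def)
  then have "jordan_matrix (map (Pair 1) as) = diag_block_mat (map (\<lambda>a. mat 1 1 (\<lambda>_. a)) as)"
    unfolding jordan_matrix_def map_map by (intro arg_cong[of _ _ diag_block_mat] map_cong) auto
  then show ?thesis by (simp only: diag_block_mat_singletons)
qed

text \<open>Blocks of size one involve only the derivative of order zero, which is \<open>f\<close> itself.\<close>

lemma jordan_matrix_fun_singletons:
  "jordan_matrix_fun D f (map (Pair 1) as) = diag_fun f (jordan_matrix (map (Pair 1) as))"
proof -
  have "(case Pair (Suc 0) a of (n, a) \<Rightarrow> jordan_block_fun D f n a) = mat 1 1 (\<lambda>_. f a)" for a
    by (rule eq_matI) (auto simp: jordan_block_fun_def nth_deriv_within_def)
  then have "jordan_matrix_fun D f (map (Pair 1) as) =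
      diag_block_mat (map (\<lambda>a. mat 1 1 (\<lambda>_. f a)) as)"
    unfolding jordan_matrix_fun_def map_map
    by (intro arg_cong[of _ _ diag_block_mat] map_cong) auto
  then show ?thesis
    by (auto simp only: diag_block_mat_singletons jordan_matrix_singletons diag_fun_def intro!: eq_matI)
      auto
qed

lemma diagonal_jordan_matrix_singletons: "diagonal_mat (jordan_matrix (map (Pair 1) as))"
  by (simp add: jordan_matrix_singletons[simplified] diagonal_mat_def)

lemma diagonal_is_jordan_matrix:
  assumes "Z \<in> carrier_mat n n" "diagonal_mat Z"
  shows "jordan_matrix (map (Pair 1) (map (\<lambda>i. Z $$ (i, i)) [0..<n])) = Z"
  unfolding jordan_matrix_singletons using assms by (intro eq_matI) (auto simp: diagonal_mat_def)

text \<open>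
  A diagonal matrix is itself a Jordan matrix with blocks of size one, and the set of blocks in a
  Jordan normal form is determined by the similarity class.
\<close>

lemma jordan_nf_diagonalizable:
  fixes A Z :: "complex mat"
  assumes Z: "Z \<in> carrier_mat n n" "diagonal_mat Z" and sim: "similar_mat A Z"
    and nf: "jordan_nf A n_as"
  obtains as where "n_as = map (Pair 1) as"
proof
  let ?ds = "map (Pair 1) (map (\<lambda>i. Z $$ (i, i)) [0..<n])"
  have "jordan_nf A ?ds"
    using sim unfolding jordan_nf_def diagonal_is_jordan_matrix[OF Z] by auto
  from jordan_nf_unique[OF nf this] have "\<forall>na \<in> set n_as. fst na = 1" by auto
  then show "n_as = map (Pair 1) (map snd n_as)"
    by (intro nth_equalityI) (auto simp: prod_eq_iff)
qed

text \<open>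
  The given diagonalization is one admissible Jordan decomposition. If \<open>A = T J T'\<close> is another
  one, then \<open>J\<close> is diagonal and \<open>S' T\<close> intertwines \<open>Z\<close> with \<open>J\<close>, hence also their images under
  \<open>f\<close>. So both decompositions give the same matrix, and the description in \<open>mat_fun\<close> is a proper
  one.
\<close>

lemma mat_fun_diagonalizable:
  assumes sim: "similar_mat_wit A Z S S'" and diag: "diagonal_mat Z"
  shows "mat_fun D f A = S * diag_fun f Z * S'"
  unfolding mat_fun_def
proof (rule the_equality)
  define n where "n = dim_row A"
  note A = similar_mat_witD[OF n_def sim]
  let ?ds = "map (\<lambda>i. Z $$ (i, i)) [0..<n]"
  have J: "jordan_matrix (map (Pair 1) ?ds) = Z"
    by (rule diagonal_is_jordan_matrix[OF A(5) diag])
  show "\<exists>n_as T T'. 0 \<notin> fst ` set n_as \<and> similar_mat_wit A (jordan_matrix n_as) T T' \<and>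
      S * diag_fun f Z * S' = T * jordan_matrix_fun D f n_as * T'"
    by (intro exI[of _ "map (Pair 1) ?ds"] exI[of _ S] exI[of _ S'] conjI)
      (use sim in \<open>auto simp only: jordan_matrix_fun_singletons J\<close>, auto)
next
  fix F
  assume "\<exists>n_as T T'. 0 \<notin> fst ` set n_as \<and> similar_mat_wit A (jordan_matrix n_as) T T' \<and>
      F = T * jordan_matrix_fun D f n_as * T'"
  then obtain n_as T T' where pos: "0 \<notin> fst ` set n_as"
    and wit: "similar_mat_wit A (jordan_matrix n_as) T T'"
    and F: "F = T * jordan_matrix_fun D f n_as * T'" by blast
  define n where "n = dim_row A"
  note A = similar_mat_witD[OF n_def sim] and A' = similar_mat_witD[OF n_def wit]
  have "jordan_nf A n_as" using pos wit by (auto simp: jordan_nf_def similar_mat_def)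
  moreover have "similar_mat A Z" using sim by (auto simp: similar_mat_def)
  ultimately obtain as where n_as: "n_as = map (Pair 1) as"
    using jordan_nf_diagonalizable[OF A(5) diag] by blast
  let ?J = "jordan_matrix n_as"
  have J: "?J \<in> carrier_mat n n" "diagonal_mat ?J"
    using A' diagonal_jordan_matrix_singletons by (simp_all add: n_as)
  have fun_J: "jordan_matrix_fun D f n_as = diag_fun f ?J"
    by (simp only: n_as jordan_matrix_fun_singletons)
  note carr = A(4-7) A'(5-7) diag_fun_carrier[OF A(5), of f] diag_fun_carrier[OF J(1), of f]
  note [simp] = assoc_mult_mat[of _ n n _ n _ n]
  from similar_mat_wit_trans[OF similar_mat_wit_sym[OF sim] wit]
  have W: "similar_mat_wit Z ?J (S' * T) (T' * S)" .
  note W' = similar_mat_witD2[OF A(5) W]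
  have comm: "diag_fun f Z * (S' * T) = S' * T * diag_fun f ?J"
    by (rule diag_fun_intertwines[OF A(5) diag J W'(6) similar_mat_wit_intertwines[OF W]])
  have "F = (S * S') * T * diag_fun f ?J * T'"
    using carr by (simp add: F fun_J A(1))
  also have "\<dots> = S * (S' * T * diag_fun f ?J) * T'" using carr by simp
  also have "\<dots> = S * diag_fun f Z * S' * (T * T')"
    using carr by (simp del: diag_fun_carrier flip: comm)
  also have "\<dots> = S * diag_fun f Z * S'" using carr by (simp add: A'(1))
  finally show "F = S * diag_fun f Z * S'" .
qed

lemma mat_fun_similar_diagonal:
  assumes "similar_mat_wit A Z S S'" and "diagonal_mat Z"
  shows "mat_fun D f A = S * mat_fun D f Z * S'"
proof -
  note Z = similar_mat_witD(5)[OF refl assms(1)]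
  have "mat_fun D f Z = diag_fun f Z"
    by (simp only: mat_fun_diagonalizable[OF similar_mat_wit_refl[OF Z] assms(2)]
      left_mult_one_mat[OF diag_fun_carrier[OF Z]] right_mult_one_mat[OF diag_fun_carrier[OF Z]])
  then show ?thesis by (simp only: mat_fun_diagonalizable[OF assms])
qed


section \<open>Kronecker products\<close>

text \<open>
  Indices of a Kronecker product are numbers below a product, read as pairs of quotient and
  remainder; this turns a sum over them into the double sum that the entrywise computations need.
\<close>

lemma sum_div_mod:
  fixes h :: "nat \<Rightarrow> nat \<Rightarrow> 'a :: comm_monoid_add"
  shows "(\<Sum>l<k * n. h (l div n) (l mod n)) = (\<Sum>c<k. \<Sum>r<n. h c r)"
proof -
  have "(\<Sum>l<k * n. h (l div n) (l mod n)) = (\<Sum>(c, r)\<in>{..<k} \<times> {..<n}. h c r)"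
  proof (rule sum.reindex_bij_witness[of _ "\<lambda>(c, r). c * n + r" "\<lambda>l. (l div n, l mod n)"])
    fix cr assume "cr \<in> {..<k} \<times> {..<n}"
    then obtain c r where cr: "cr = (c, r)" "c < k" "r < n" by auto
    then have "c * n + r < Suc c * n" by simp
    also have "\<dots> \<le> k * n" using cr by (intro mult_right_mono) auto
    finally show "(case cr of (c, r) \<Rightarrow> c * n + r) \<in> {..<k * n}" using cr by simp
  qed (auto simp: less_mult_imp_div_less intro!: mod_less_divisor, (cases "n = 0"; simp)+)
  then show ?thesis by (simp add: sum.cartesian_product)
qed

lemma dim_kron [simp]:
  "dim_row (A \<otimes>\<^sub>K B) = dim_row A * dim_row B" "dim_col (A \<otimes>\<^sub>K B) = dim_col A * dim_col B"
  by (simp_all add: kron_def)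

lemma kron_carrier [simp]:
  "A \<in> carrier_mat r c \<Longrightarrow> B \<in> carrier_mat r' c' \<Longrightarrow> A \<otimes>\<^sub>K B \<in> carrier_mat (r * r') (c * c')"
  by (auto simp: kron_def)

lemma kron_index:
  assumes "i < dim_row A * dim_row B" "j < dim_col A * dim_col B"
  shows "(A \<otimes>\<^sub>K B) $$ (i, j) =
    A $$ (i div dim_row B, j div dim_col B) * B $$ (i mod dim_row B, j mod dim_col B)"
  using assms by (simp add: kron_def)

lemma div_mod_less_of_less_mult:
  "(i::nat) < a * b \<Longrightarrow> i div b < a \<and> i mod b < b"
  by (cases "b = 0") (auto simp: less_mult_imp_div_less)

lemma kron_mult:
  fixes A B C E :: "'a :: comm_semiring_1 mat"
  assumes A: "A \<in> carrier_mat r k" and C: "C \<in> carrier_mat k c"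
    and B: "B \<in> carrier_mat r' k'" and E: "E \<in> carrier_mat k' c'"
  shows "(A \<otimes>\<^sub>K B) * (C \<otimes>\<^sub>K E) = (A * C) \<otimes>\<^sub>K (B * E)"
proof (rule eq_matI)
  fix i j assume "i < dim_row ((A * C) \<otimes>\<^sub>K (B * E))" "j < dim_col ((A * C) \<otimes>\<^sub>K (B * E))"
  then have i: "i < r * r'" and j: "j < c * c'" using assms by auto
  note i' = div_mod_less_of_less_mult[OF i] and j' = div_mod_less_of_less_mult[OF j]
  have "((A \<otimes>\<^sub>K B) * (C \<otimes>\<^sub>K E)) $$ (i, j) =
    (\<Sum>l<k * k'. (A $$ (i div r', l div k') * B $$ (i mod r', l mod k')) *
       (C $$ (l div k', j div c') * E $$ (l mod k', j mod c')))"
    using assms i j by (simp add: scalar_prod_def lessThan_atLeast0 kron_index)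
  also have "\<dots> = (\<Sum>p<k. \<Sum>q<k'. (A $$ (i div r', p) * B $$ (i mod r', q)) *
       (C $$ (p, j div c') * E $$ (q, j mod c')))"
    by (rule sum_div_mod)
  also have "\<dots> = (\<Sum>p<k. A $$ (i div r', p) * C $$ (p, j div c')) *
      (\<Sum>q<k'. B $$ (i mod r', q) * E $$ (q, j mod c'))"
    by (simp add: sum_product algebra_simps)
  also have "\<dots> = ((A * C) \<otimes>\<^sub>K (B * E)) $$ (i, j)"
    using assms i j i' j' by (simp add: scalar_prod_def lessThan_atLeast0 kron_index)
  finally show "((A \<otimes>\<^sub>K B) * (C \<otimes>\<^sub>K E)) $$ (i, j) = ((A * C) \<otimes>\<^sub>K (B * E)) $$ (i, j)" .
qed (use assms in auto)

lemma kron_one: "(1\<^sub>m p :: 'a :: semiring_1 mat) \<otimes>\<^sub>K 1\<^sub>m q = 1\<^sub>m (p * q)"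
proof (rule eq_matI)
  fix i j assume "i < dim_row (1\<^sub>m (p * q) :: 'a mat)" "j < dim_col (1\<^sub>m (p * q) :: 'a mat)"
  then have i: "i < p * q" and j: "j < p * q" by auto
  have "i = j \<longleftrightarrow> i div q = j div q \<and> i mod q = j mod q" by (metis div_mod_decomp)
  then show "((1\<^sub>m p :: 'a mat) \<otimes>\<^sub>K 1\<^sub>m q) $$ (i, j) = 1\<^sub>m (p * q) $$ (i, j)"
    using i j div_mod_less_of_less_mult[OF i] div_mod_less_of_less_mult[OF j]
    by (auto simp: kron_index)
qed auto

lemma kron_transpose: "(A \<otimes>\<^sub>K B)\<^sup>T = A\<^sup>T \<otimes>\<^sub>K B\<^sup>T"
  by (rule eq_matI) (simp_all add: kron_index div_mod_less_of_less_mult)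

lemma cmat_kron: "cmat (A \<otimes>\<^sub>K B) = cmat A \<otimes>\<^sub>K cmat B"
  by (rule eq_matI) (simp_all add: kron_index div_mod_less_of_less_mult)

lemma cmat_one: "cmat (1\<^sub>m n) = 1\<^sub>m n"
  by (rule eq_matI) auto

lemma cmat_kron_sum:
  assumes "A \<in> carrier_mat p p" "B \<in> carrier_mat q q"
  shows "cmat (kron_sum A B) = kron_sum (cmat A) (cmat B)"
proof -
  have "cmat (kron_sum A B) =
      cmat (A \<otimes>\<^sub>K 1\<^sub>m q) + cmat (1\<^sub>m p \<otimes>\<^sub>K B)"
    using assms unfolding kron_sum_def by (intro eq_matI) auto
  then show ?thesis using assms by (simp add: kron_sum_def cmat_kron cmat_one)
qed

lemma kron_sum_carrier [simp]:
  "A \<in> carrier_mat p p \<Longrightarrow> B \<in> carrier_mat q q \<Longrightarrow> kron_sum A B \<in> carrier_mat (p * q) (p * q)"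
  by (auto simp: kron_sum_def)

lemma kron_sum_diagonal:
  assumes "A \<in> carrier_mat p p" "diagonal_mat A" "B \<in> carrier_mat q q" "diagonal_mat B"
  shows "diagonal_mat (kron_sum A B)"
  unfolding diagonal_mat_def
proof (intro allI impI)
  fix i j assume "i < dim_row (kron_sum A B)" "j < dim_col (kron_sum A B)" and ne: "i \<noteq> j"
  then have i: "i < p * q" and j: "j < p * q" using assms by (auto simp: kron_sum_def)
  have "i div q \<noteq> j div q \<or> i mod q \<noteq> j mod q" using ne by (metis div_mod_decomp)
  then show "kron_sum A B $$ (i, j) = 0"
    using assms i j div_mod_less_of_less_mult[OF i] div_mod_less_of_less_mult[OF j]
    by (auto simp: kron_sum_def kron_index diagonal_mat_def)
qed

text \<open>
  By the mixed-product rule, conjugation with \<open>Y \<otimes> X\<close> acts on the two factors of each summand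
  separately, and it fixes the identity factor.
\<close>

lemma kron_sum_similar:
  fixes A B :: "'a :: comm_semiring_1 mat"
  assumes A: "A \<in> carrier_mat p p" "similar_mat_wit A \<Theta> Y Y'"
    and B: "B \<in> carrier_mat q q" "similar_mat_wit B \<Lambda> X X'"
  shows "similar_mat_wit (kron_sum A B) (kron_sum \<Theta> \<Lambda>) (Y \<otimes>\<^sub>K X) (Y' \<otimes>\<^sub>K X')"
proof -
  note a = similar_mat_witD2[OF A] and b = similar_mat_witD2[OF B]
  note carr = a(4-7) b(4-7)
  let ?n = "p * q"
  have 1: "(Y \<otimes>\<^sub>K X) * (\<Theta> \<otimes>\<^sub>K 1\<^sub>m q) * (Y' \<otimes>\<^sub>K X') = A \<otimes>\<^sub>K 1\<^sub>m q"
    using carr by (simp add: kron_mult[of _ p p _ p _ q q _ q] a(3)[symmetric] b(1))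
  have 2: "(Y \<otimes>\<^sub>K X) * (1\<^sub>m p \<otimes>\<^sub>K \<Lambda>) * (Y' \<otimes>\<^sub>K X') = 1\<^sub>m p \<otimes>\<^sub>K B"
    using carr by (simp add: kron_mult[of _ p p _ p _ q q _ q] b(3)[symmetric] a(1))
  have "(Y \<otimes>\<^sub>K X) * kron_sum \<Theta> \<Lambda> * (Y' \<otimes>\<^sub>K X') =
      ((Y \<otimes>\<^sub>K X) * (\<Theta> \<otimes>\<^sub>K 1\<^sub>m q) + (Y \<otimes>\<^sub>K X) * (1\<^sub>m p \<otimes>\<^sub>K \<Lambda>)) * (Y' \<otimes>\<^sub>K X')"
    using carr unfolding kron_sum_def by (subst mult_add_distrib_mat[of _ ?n ?n _ ?n]) auto
  also have "\<dots> = A \<otimes>\<^sub>K 1\<^sub>m q + 1\<^sub>m p \<otimes>\<^sub>K B"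
    unfolding 1[symmetric] 2[symmetric] using carr
    by (intro add_mult_distrib_mat[of _ ?n ?n _ _ ?n] mult_carrier_mat[of _ ?n ?n]) auto
  finally have "kron_sum A B = (Y \<otimes>\<^sub>K X) * kron_sum \<Theta> \<Lambda> * (Y' \<otimes>\<^sub>K X')"
    using carr by (simp add: kron_sum_def)
  from similar_mat_witI[OF _ _ this, of ?n] show ?thesis
    using carr by (simp add: kron_mult[of _ p p _ p _ q q _ q] a(1,2) b(1,2) kron_one)
qed


section \<open>Vectorization\<close>

lemma mult_mat_flatten:
  assumes "A \<in> carrier_mat p q" "B \<in> carrier_mat q r" "C \<in> carrier_mat r s" "E \<in> carrier_mat s t"
  shows "A * (B * C * E) = A * B * C * (E :: 'a :: semiring_0 mat)"
proof -
  have "A * (B * C * E) = A * (B * C) * E"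
    using assms by (intro assoc_mult_mat[symmetric]) auto
  then show ?thesis using assms by (simp add: assoc_mult_mat[of A p q B r C s])
qed

lemma stack_cols_carrier [simp]: "A \<in> carrier_mat r c \<Longrightarrow> stack_cols A \<in> carrier_vec (c * r)"
  by (auto simp: stack_cols_def mult.commute)

lemma cvec_stack_cols: "cvec (stack_cols A) = stack_cols (cmat A)"
proof (rule eq_vecI)
  fix k assume "k < dim_vec (stack_cols (cmat A))"
  then have k: "k < dim_col A * dim_row A" by (simp add: stack_cols_def mult.commute)
  then show "cvec (stack_cols A) $ k = stack_cols (cmat A) $ k"
    using div_mod_less_of_less_mult[OF k] by (simp add: stack_cols_def mult.commute)
qed (simp add: stack_cols_def)

text \<open>
  Position \<open>i\<close> of a stacked matrix with \<open>p\<close> rows is row \<open>i mod p\<close> of column \<open>i div p\<close>. Hence the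
  right factor \<open>B\<close>, whose indices vary fastest, acts on the columns of \<open>W\<close>, and the left factor
  \<open>A\<close> combines columns, which is multiplication by \<open>A\<^sup>T\<close> from the right.
\<close>

lemma kron_mult_stack_cols:
  fixes A B W :: "'a :: comm_semiring_1 mat"
  assumes A: "A \<in> carrier_mat q k" and W: "W \<in> carrier_mat n k" and B: "B \<in> carrier_mat p n"
  shows "(A \<otimes>\<^sub>K B) *\<^sub>v stack_cols W = stack_cols (B * W * A\<^sup>T)"
proof (rule eq_vecI)
  fix i assume "i < dim_vec (stack_cols (B * W * A\<^sup>T))"
  then have i: "i < q * p" using assms by (simp add: stack_cols_def mult.commute)
  note i' = div_mod_less_of_less_mult[OF i]
  have "((A \<otimes>\<^sub>K B) *\<^sub>v stack_cols W) $ i =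
    (\<Sum>l<k * n. (A $$ (i div p, l div n) * B $$ (i mod p, l mod n)) * W $$ (l mod n, l div n))"
    using assms i
    by (simp add: scalar_prod_def lessThan_atLeast0 kron_index stack_cols_def mult.commute[of n])
  also have "\<dots> = (\<Sum>c<k. \<Sum>r<n. (A $$ (i div p, c) * B $$ (i mod p, r)) * W $$ (r, c))"
    by (rule sum_div_mod)
  also have "\<dots> = (\<Sum>c<k. (\<Sum>r<n. B $$ (i mod p, r) * W $$ (r, c)) * A $$ (i div p, c))"
    unfolding sum_distrib_right by (intro sum.cong refl) (simp add: mult_ac)
  also have "\<dots> = stack_cols (B * W * A\<^sup>T) $ i"
    using assms i i'
    by (simp add: scalar_prod_def lessThan_atLeast0 stack_cols_def mult.commute[of p]
        del: assoc_mult_mat)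
  finally show "((A \<otimes>\<^sub>K B) *\<^sub>v stack_cols W) $ i = stack_cols (B * W * A\<^sup>T) $ i" .
qed (use assms in \<open>simp add: stack_cols_def mult.commute\<close>)


section \<open>The Kronecker approximation\<close>

theorem proposition3p1:
  fixes n1 n2 m :: nat
    and M1 M2 Q P T1 T2 :: "real mat"
    and b1 b2 b :: "real vec"
    and D :: "complex set" and f :: "complex \<Rightarrow> complex"
    and X X_inv \<Lambda> Y Y_inv \<Theta> G :: "complex mat"
    and g :: "complex vec"
  assumes M1: "M1 \<in> carrier_mat n1 n1" and M2: "M2 \<in> carrier_mat n2 n2"
    and b1: "b1 \<in> carrier_vec n1" and b2: "b2 \<in> carrier_vec n2"
    and b: "b = stack_cols (outer_prod b1 b2)"
    and Q: "Q \<in> carrier_mat n1 m" "orthonormal_basis_cols Q (krylov m M1 b1)"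
    and P: "P \<in> carrier_mat n2 m" "orthonormal_basis_cols P (krylov m M2 b2)"
    and T1: "T1 = Q\<^sup>T * M1 * Q" and T2: "T2 = P\<^sup>T * M2 * P"
    and f_A: "mat_fun_defined D f (cmat (kron_sum M2 M1))"
    and f_T: "mat_fun_defined D f (cmat (kron_sum T2 T1))"
    and eig_T1: "similar_mat_wit (cmat T1) \<Lambda> X X_inv" "diagonal_mat \<Lambda>"
    and eig_T2: "similar_mat_wit (cmat T2) \<Theta> Y Y_inv" "diagonal_mat \<Theta>"
    and g: "g = mat_fun D f (kron_sum \<Theta> \<Lambda>) *\<^sub>v
      stack_cols (X_inv * cmat (Q\<^sup>T) * cmat (outer_prod b1 b2) * cmat P * Y_inv\<^sup>T)"
    and G: "G \<in> carrier_mat m m" "g = stack_cols G"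
  shows "kron_approx D f M1 M2 Q P b = stack_cols (cmat Q * X * G * Y\<^sup>T * cmat (P\<^sup>T))"
proof -
  define B where "B = cmat (outer_prod b1 b2)"
  define F where "F = mat_fun D f (kron_sum \<Theta> \<Lambda>)"
  have T: "T1 \<in> carrier_mat m m" "T2 \<in> carrier_mat m m"
    using Q P M1 M2 by (auto simp: T1 T2)
  have cT: "cmat T1 \<in> carrier_mat m m" "cmat T2 \<in> carrier_mat m m" using T by auto
  note e1 = similar_mat_witD2[OF cT(1) eig_T1(1)] and e2 = similar_mat_witD2[OF cT(2) eig_T2(1)]
  have QP: "cmat Q \<in> carrier_mat n1 m" "cmat P \<in> carrier_mat n2 m"
    "cmat (Q\<^sup>T) \<in> carrier_mat m n1" "cmat (P\<^sup>T) \<in> carrier_mat m n2"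
    using Q P by auto
  have YT: "Y\<^sup>T \<in> carrier_mat m m" using e2(6) by simp
  have B: "B \<in> carrier_mat n1 n2" using b1 b2 by (auto simp: B_def outer_prod_def)
  note carr = e1(4-7) e2(4-7) QP B G(1)
  have sim: "similar_mat_wit (cmat (kron_sum T2 T1)) (kron_sum \<Theta> \<Lambda>) (Y \<otimes>\<^sub>K X) (Y_inv \<otimes>\<^sub>K X_inv)"
    unfolding cmat_kron_sum[OF T(2,1)] by (rule kron_sum_similar[OF cT(2) eig_T2(1) cT(1) eig_T1(1)])
  have diag: "diagonal_mat (kron_sum \<Theta> \<Lambda>)"
    by (rule kron_sum_diagonal[OF e2(5) eig_T2(2) e1(5) eig_T1(2)])
  have fT: "mat_fun D f (cmat (kron_sum T2 T1)) = (Y \<otimes>\<^sub>K X) * F * (Y_inv \<otimes>\<^sub>K X_inv)"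
    unfolding F_def by (rule mat_fun_similar_diagonal[OF sim diag])
  have F: "F \<in> carrier_mat (m * m) (m * m)"
    unfolding F_def mat_fun_diagonalizable[OF similar_mat_wit_refl diag, OF kron_sum_carrier[OF e2(5) e1(5)]]
    using carr by (intro mult_carrier_mat[of _ "m * m" "m * m"]) auto
  note KS = kron_carrier[OF e2(6) e1(6)] kron_carrier[OF e2(7) e1(7)]
    kron_carrier[OF QP(2,1)] kron_carrier[OF QP(4,3)]
  have sB: "stack_cols B \<in> carrier_vec (n2 * n1)" using B by simp
  note YFY = mult_carrier_mat[OF mult_carrier_mat[OF KS(1) F] KS(2)]
    and w = mult_mat_vec_carrier[OF KS(4) sB]
  have tP: "(cmat (P\<^sup>T))\<^sup>T = cmat P" and tP': "(cmat P)\<^sup>T = cmat (P\<^sup>T)" by (auto intro: eq_matI)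
  have "(Y_inv \<otimes>\<^sub>K X_inv) *\<^sub>v ((cmat (P\<^sup>T) \<otimes>\<^sub>K cmat (Q\<^sup>T)) *\<^sub>v stack_cols B) =
      stack_cols (X_inv * (cmat (Q\<^sup>T) * B * cmat P) * Y_inv\<^sup>T)"
    using carr
    by (simp add: kron_mult_stack_cols[OF QP(4) B QP(3)] tP
      kron_mult_stack_cols[OF e2(7) _ e1(7)])
  also have "X_inv * (cmat (Q\<^sup>T) * B * cmat P) * Y_inv\<^sup>T =
      X_inv * cmat (Q\<^sup>T) * B * cmat P * Y_inv\<^sup>T"
    by (simp only: mult_mat_flatten[OF e1(7) QP(3) B QP(2)])
  finally have inner: "F *\<^sub>v ((Y_inv \<otimes>\<^sub>K X_inv) *\<^sub>v
      ((cmat (P\<^sup>T) \<otimes>\<^sub>K cmat (Q\<^sup>T)) *\<^sub>v stack_cols B)) = stack_cols G"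
    unfolding G(2)[symmetric] g F_def B_def by simp
  have "kron_approx D f M1 M2 Q P b =
      ((cmat P \<otimes>\<^sub>K cmat Q) * ((Y \<otimes>\<^sub>K X) * F * (Y_inv \<otimes>\<^sub>K X_inv)) *
        (cmat (P\<^sup>T) \<otimes>\<^sub>K cmat (Q\<^sup>T))) *\<^sub>v stack_cols B"
    unfolding kron_approx_def T1[symmetric] T2[symmetric] fT b B_def
    by (simp only: kron_transpose cmat_kron cvec_stack_cols)
  also have "\<dots> = (cmat P \<otimes>\<^sub>K cmat Q) *\<^sub>v ((Y \<otimes>\<^sub>K X) *\<^sub>v (F *\<^sub>v ((Y_inv \<otimes>\<^sub>K X_inv) *\<^sub>v
      ((cmat (P\<^sup>T) \<otimes>\<^sub>K cmat (Q\<^sup>T)) *\<^sub>v stack_cols B))))"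
    by (simp only: assoc_mult_mat_vec[OF mult_carrier_mat[OF KS(3) YFY] KS(4) sB]
        assoc_mult_mat_vec[OF KS(3) YFY w]
        assoc_mult_mat_vec[OF mult_carrier_mat[OF KS(1) F] KS(2) w]
        assoc_mult_mat_vec[OF KS(1) F mult_mat_vec_carrier[OF KS(2) w]])
  also have "\<dots> = stack_cols (cmat Q * (X * G * Y\<^sup>T) * cmat (P\<^sup>T))"
    unfolding inner using carr
    by (simp add: kron_mult_stack_cols[OF e2(6) G(1) e1(6)] kron_mult_stack_cols[OF QP(2) _ QP(1)] tP')
  also have "cmat Q * (X * G * Y\<^sup>T) * cmat (P\<^sup>T) = cmat Q * X * G * Y\<^sup>T * cmat (P\<^sup>T)"
    by (simp only: mult_mat_flatten[OF QP(1) e1(6) G(1) YT])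
  finally show ?thesis .
qed

end
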